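(* There exists an irreducible $12$-dimensional real Lie algebra with an ad-invariant metric that is not nice.
   Context: An ad-invariant metric on a Lie algebra is a nondegenerate symmetric bilinear form $g$ (any signature) with $g([X,Y],Z)=-g(Y,[X,Z])$ for all $X,Y,Z$. A Lie algebra is irreducible if it is not a direct sum of two nonzero ideals. A Lie algebra is nice if it has a nice basis, i.e. a basis $\{e_1,\dots,e_n\}$ with dual basis $\{e^1,\dots,e^n\}$ such that each $[e_i,e_j]$ is a (possibly zero) multiple of a basis element and each interior product $e_i\lrcorner\, de^j$ is a (possibly zero) multiple of an element of the dual basis, where $d$ is the Chevalley–Eilenberg differential, $de^k(X,Y)=-e^k([X,Y])$. *)

theory Defs
  imports "HOL-Analysis.Analysis"
begin

text \<open>A real Lie algebra is a real vector space, given as a type, together with a bracket on it.\<close>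

definition lie_algebra :: "('a::real_vector \<Rightarrow> 'a \<Rightarrow> 'a) \<Rightarrow> bool" where
  "lie_algebra br \<longleftrightarrow>
     bilinear br \<and>
     (\<forall>x. br x x = 0) \<and>
     (\<forall>x y z. br x (br y z) + br y (br z x) + br z (br x y) = 0)"

definition ad_invariant_metric ::
  "('a::real_vector \<Rightarrow> 'a \<Rightarrow> 'a) \<Rightarrow> ('a \<Rightarrow> 'a \<Rightarrow> real) \<Rightarrow> bool" where
  "ad_invariant_metric br g \<longleftrightarrow>
     bilinear g \<and>
     (\<forall>x y. g x y = g y x) \<and>
     (\<forall>x. (\<forall>y. g x y = 0) \<longrightarrow> x = 0) \<and>
     (\<forall>x y z. g (br x y) z = - g y (br x z))"

definition lie_ideal :: "('a::real_vector \<Rightarrow> 'a \<Rightarrow> 'a) \<Rightarrow> 'a set \<Rightarrow> bool" where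
  "lie_ideal br I \<longleftrightarrow> subspace I \<and> (\<forall>x. \<forall>y\<in>I. br x y \<in> I)"

definition irreducible_lie :: "('a::real_vector \<Rightarrow> 'a \<Rightarrow> 'a) \<Rightarrow> bool" where
  "irreducible_lie br \<longleftrightarrow>
     \<not> (\<exists>I J. lie_ideal br I \<and> lie_ideal br J \<and> I \<noteq> {0} \<and> J \<noteq> {0} \<and>
           I \<inter> J = {0} \<and> {x + y | x y. x \<in> I \<and> y \<in> J} = UNIV)"

definition vs_basis :: "'a::real_vector set \<Rightarrow> bool" where
  "vs_basis B \<longleftrightarrow> independent B \<and> span B = UNIV"

text \<open>A basis is an unordered set of vectors; the element of the dual basis belonging to
  \<open>b \<in> B\<close> is the coordinate function along \<open>b\<close>.\<close>

definition dual_vec :: "'a::real_vector set \<Rightarrow> 'a \<Rightarrow> 'a \<Rightarrow> real" where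
  "dual_vec B b = (\<lambda>x. representation B x b)"

text \<open>The Chevalley--Eilenberg differential on 1-forms.\<close>

definition ce_diff ::
  "('a::real_vector \<Rightarrow> 'a \<Rightarrow> 'a) \<Rightarrow> ('a \<Rightarrow> real) \<Rightarrow> ('a \<Rightarrow> 'a \<Rightarrow> real)" where
  "ce_diff br \<alpha> = (\<lambda>x y. - \<alpha> (br x y))"

definition interior_prod :: "'a \<Rightarrow> ('a \<Rightarrow> 'a \<Rightarrow> real) \<Rightarrow> ('a \<Rightarrow> real)" where
  "interior_prod x \<omega> = (\<lambda>y. \<omega> x y)"

definition nice_basis :: "('a::real_vector \<Rightarrow> 'a \<Rightarrow> 'a) \<Rightarrow> 'a set \<Rightarrow> bool" where
  "nice_basis br B \<longleftrightarrow>
     vs_basis B \<and>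
     (\<forall>a\<in>B. \<forall>b\<in>B. \<exists>c. \<exists>k\<in>B. br a b = c *\<^sub>R k) \<and>
     (\<forall>a\<in>B. \<forall>b\<in>B. \<exists>c. \<exists>k\<in>B.
        interior_prod a (ce_diff br (dual_vec B b)) = (\<lambda>y. c * dual_vec B k y))"

definition nice_lie :: "('a::real_vector \<Rightarrow> 'a \<Rightarrow> 'a) \<Rightarrow> bool" where
  "nice_lie br \<longleftrightarrow> (\<exists>B. nice_basis br B)"

end

theory Submission
  imports Defs
begin

text \<open>
  The example is a double extension \<open>\<real>d \<oplus> V \<oplus> \<real>z\<close> of an abelian Lie algebra \<open>V\<close> with a
  nondegenerate symmetric form \<open>h\<close> by an invertible \<open>h\<close>-skew map \<open>D\<close>:
  \<open>[d, v] = D v\<close>, \<open>[v, w] = h (D v) w z\<close> and \<open>z\<close> central. It carries the invariant metric that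
  extends \<open>h\<close> and pairs \<open>d\<close> with \<open>z\<close>. It is irreducible because every nonzero ideal contains
  \<open>z\<close>: bracketing an element outside \<open>\<real>z\<close> with suitable elements of \<open>V\<close>, at most twice, ends in a
  nonzero multiple of \<open>z\<close>.

  Being nice constrains the spectrum of \<open>D\<close>. For an element \<open>b\<close> of a nice basis, \<open>ad b\<close> sends
  every basis vector to a multiple of a basis vector, so the orbit of a basis vector returns,
  up to a scalar, to a line that it met before. Hence some power \<open>\<mu> ^ m\<close> (\<open>m > 0\<close>) of each
  nonzero complex eigenvalue \<open>\<mu>\<close> of \<open>ad b\<close> is real. Some basis element \<open>b\<close> has a nonzero
  \<open>d\<close>-coefficient \<open>s\<close>, and then \<open>s \<alpha>\<close> is an eigenvalue of \<open>ad b\<close> whenever \<open>\<alpha>\<close> is an eigenvalue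
  of \<open>D\<close>. So it is enough that \<open>D\<close> has an eigenvalue with no real positive power, such as
  \<open>2 + \<i>\<close>. A skew map with this eigenvalue exists on \<open>\<complex> \<times> \<complex>\<close>, and a hyperbolic summand
  \<open>\<real>\<^sup>3 \<times> \<real>\<^sup>3\<close> fills \<open>V\<close> up to dimension 10.
\<close>

section \<open>Nice bases and eigenvalues\<close>

text \<open>The maps \<open>\<pi>\<close> are eigenvectors of the transpose of \<open>ad b\<close>. Working with them instead of
  eigenvectors of \<open>ad b\<close> avoids complexifying the Lie algebra, and a functional, unlike a vector,
  is tested on the basis: it is nonzero on some basis vector \<open>x\<close>. The \<open>ad b\<close>-orbit of \<open>x\<close> is
  \<open>c n *\<^sub>R k n\<close> with basis vectors \<open>k n\<close>, and two equal \<open>k i\<close>, \<open>k j\<close> make \<open>\<mu> ^ (j - i)\<close> equal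
  to \<open>c j / c i\<close>.\<close>

lemma not_nice_if_eigenvalue_without_real_power:
  fixes br :: "'a::euclidean_space \<Rightarrow> 'a \<Rightarrow> 'a" and \<delta> :: "'a \<Rightarrow> real" and \<alpha> :: complex
  assumes br: "bilinear br"
    and \<delta>: "linear \<delta>" "\<delta> d \<noteq> 0"
    and eigen: "\<And>b. \<delta> b \<noteq> 0 \<Longrightarrow>
      \<exists>\<pi>. linear \<pi> \<and> (\<exists>v. \<pi> v \<noteq> 0) \<and> (\<forall>x. \<pi> (br b x) = complex_of_real (\<delta> b) * \<alpha> * \<pi> x)"
    and nonreal: "\<And>m. m > 0 \<Longrightarrow> \<alpha> ^ m \<notin> \<real>"
  shows "\<not> nice_lie br"
proof
  assume "nice_lie br"
  then obtain B where ind: "independent B" and span: "span B = UNIV"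
    and nice: "\<And>a b. a \<in> B \<Longrightarrow> b \<in> B \<Longrightarrow> \<exists>c. \<exists>k\<in>B. br a b = c *\<^sub>R k"
    unfolding nice_lie_def nice_basis_def vs_basis_def by blast
  have finB: "finite B"
    using ind by (rule independent_imp_finite)
  have nonzero_on_B: "\<exists>b\<in>B. f b \<noteq> 0" if "linear f" "f v \<noteq> 0" for f :: "'a \<Rightarrow> 'b::real_vector" and v
    using linear_eq_0_on_span[OF that(1), of B v] that(2) span by blast
  obtain b where b: "b \<in> B" "\<delta> b \<noteq> 0"
    using nonzero_on_B[OF \<delta>] by blast
  obtain \<pi> v where \<pi>: "linear \<pi>" "\<pi> v \<noteq> 0"
    and \<pi>_br: "\<And>x. \<pi> (br b x) = complex_of_real (\<delta> b) * \<alpha> * \<pi> x"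
    using eigen[OF b(2)] by blast
  obtain x where x: "x \<in> B" "\<pi> x \<noteq> 0"
    using nonzero_on_B[OF \<pi>] by blast
  define \<mu> where "\<mu> = complex_of_real (\<delta> b) * \<alpha>"
  have "\<alpha> \<noteq> 0"
    using nonreal[of 1] by auto
  then have "\<mu> \<noteq> 0"
    using b by (simp add: \<mu>_def)
  have orbit: "\<exists>k\<in>B. \<exists>c. (br b ^^ n) x = c *\<^sub>R k" for n
  proof (induction n)
    case 0
    then show ?case using x by (auto intro!: bexI[of _ x] exI[of _ 1])
  next
    case (Suc n)
    then obtain k c where k: "k \<in> B" "(br b ^^ n) x = c *\<^sub>R k" by blast
    obtain c' k' where "k' \<in> B" "br b k = c' *\<^sub>R k'"
      using nice[OF b(1) k(1)] by blast
    then show ?case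
      using k by (auto simp: bilinear_rmul[OF br] intro!: bexI[of _ k'] exI[of _ "c * c'"])
  qed
  then obtain k c where k: "\<And>n. k n \<in> B" and kc: "\<And>n. (br b ^^ n) x = c n *\<^sub>R k n"
    by metis
  have "\<pi> ((br b ^^ n) x) = \<mu> ^ n * \<pi> x" for n
    by (induction n) (simp_all add: \<pi>_br \<mu>_def)
  then have \<pi>_orbit: "\<mu> ^ n * \<pi> x = complex_of_real (c n) * \<pi> (k n)" for n
    by (metis kc linear_scale[OF \<pi>(1)] scaleR_conv_of_real)
  have "\<not> inj k"
    using finB k by (meson finite_subset image_subsetI finite_imageD infinite_UNIV_nat)
  then obtain i j where ij: "i < j" "k i = k j"
    by (metis injI linorder_neqE_nat)
  have nz: "\<mu> ^ i * \<pi> x \<noteq> 0"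
    using \<open>\<mu> \<noteq> 0\<close> x by simp
  then have ci: "c i \<noteq> 0" "\<pi> (k i) \<noteq> 0"
    using \<pi>_orbit[of i] by auto
  have "\<mu> ^ (j - i) * (\<mu> ^ i * \<pi> x) = \<mu> ^ j * \<pi> x"
    using ij by (simp add: power_add[symmetric] flip: mult.assoc)
  also have "\<dots> = complex_of_real (c j) * \<pi> (k i)"
    using \<pi>_orbit[of j] ij by simp
  also have "\<dots> = complex_of_real (c j / c i) * (\<mu> ^ i * \<pi> x)"
    unfolding \<pi>_orbit[of i] using ci by simp
  finally have "\<mu> ^ (j - i) = complex_of_real (c j / c i)"
    using nz mult_right_cancel by blast
  then have "\<alpha> ^ (j - i) = complex_of_real (c j / c i / \<delta> b ^ (j - i))"
    using b ci by (simp add: \<mu>_def power_mult_distrib eq_divide_eq mult.commute mult.left_commute)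
  then have "\<alpha> ^ (j - i) \<in> \<real>"
    by (metis Reals_of_real)
  with nonreal[of "j - i"] ij show False by simp
qed

text \<open>Modulo 5, the powers of \<open>2 + \<i>\<close> stay on the line \<open>x = 2 y\<close>, on which multiplication by
  \<open>2 + \<i>\<close> is multiplication by the unit 4. So the imaginary part is never divisible by 5.\<close>

lemma power_two_plus_i_not_real:
  assumes "m > 0"
  shows "Complex 2 1 ^ m \<notin> \<real>"
proof -
  have "\<exists>k y :: int. Complex 2 1 ^ m = Complex (of_int (2 * y + 5 * k)) (of_int y) \<and> \<not> 5 dvd y"
    using assms
  proof (induction m rule: nat_induct_non_zero)
    case 1
    show ?case by (intro exI[of _ 0] exI[of _ 1]) simp
  next
    case (Suc m)
    then obtain k y :: int
      where ky: "Complex 2 1 ^ m = Complex (of_int (2 * y + 5 * k)) (of_int y)" "\<not> 5 dvd y"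
      by blast
    have "Complex 2 1 ^ Suc m =
        Complex (of_int (2 * (4 * y + 5 * k) + 5 * (- y))) (of_int (4 * y + 5 * k))"
      using ky(1) by (simp add: complex_eq_iff)
    moreover have "\<not> 5 dvd 4 * y + 5 * k"
      using ky(2) by presburger
    ultimately show ?case by blast
  qed
  then show ?thesis
    by (auto simp: complex_is_Real_iff)
qed

section \<open>Double extensions\<close>

text \<open>The triple \<open>(s, v, t)\<close> stands for \<open>s d + v + t z\<close>.\<close>

definition double_extension ::
  "('v::real_vector \<Rightarrow> 'v \<Rightarrow> real) \<Rightarrow> ('v \<Rightarrow> 'v) \<Rightarrow>
    real \<times> 'v \<times> real \<Rightarrow> real \<times> 'v \<times> real \<Rightarrow> real \<times> 'v \<times> real" where
  "double_extension h D = (\<lambda>(s, v, t) (s', v', t').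
     (0, s *\<^sub>R D v' - s' *\<^sub>R D v, h (D v) v'))"

definition double_extension_metric ::
  "('v::real_vector \<Rightarrow> 'v \<Rightarrow> real) \<Rightarrow> real \<times> 'v \<times> real \<Rightarrow> real \<times> 'v \<times> real \<Rightarrow> real" where
  "double_extension_metric h = (\<lambda>(s, v, t) (s', v', t'). s * t' + t * s' + h v v')"

locale skew_map =
  fixes h :: "'v::real_vector \<Rightarrow> 'v \<Rightarrow> real" and D :: "'v \<Rightarrow> 'v"
  assumes bilinear_h: "bilinear h"
    and sym_h: "h u v = h v u"
    and nondegenerate_h: "(\<And>v. h u v = 0) \<Longrightarrow> u = 0"
    and linear_D: "linear D"
    and skew_D: "h (D u) v = - h u (D v)"
begin

lemmas h_simps =
  bilinear_ladd[OF bilinear_h] bilinear_radd[OF bilinear_h]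
  bilinear_lsub[OF bilinear_h] bilinear_rsub[OF bilinear_h]
  bilinear_lmul[OF bilinear_h] bilinear_rmul[OF bilinear_h]
  bilinear_lzero[OF bilinear_h] bilinear_rzero[OF bilinear_h]

lemmas D_simps =
  linear_add[OF linear_D] linear_diff[OF linear_D] linear_scale[OF linear_D] linear_0[OF linear_D]

lemma lie_algebra_double_extension: "lie_algebra (double_extension h D)"
proof -
  have "h (D v) v = 0" for v
    using skew_D[of v v] sym_h[of v "D v"] by simp
  moreover have "bilinear (double_extension h D)"
    by (auto simp: bilinear_def double_extension_def h_simps D_simps algebra_simps intro!: linearI)
  ultimately show ?thesis
    unfolding lie_algebra_def
    by (auto simp: double_extension_def h_simps D_simps zero_prod_def algebra_simps sym_h)
qed

lemma ad_invariant_double_extension_metric: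
  "ad_invariant_metric (double_extension h D) (double_extension_metric h)"
proof -
  have "bilinear (double_extension_metric h)"
    by (auto simp: bilinear_def double_extension_metric_def h_simps algebra_simps intro!: linearI)
  moreover have "x = 0" if x: "\<forall>y. double_extension_metric h x y = 0" for x
  proof -
    obtain s v t where [simp]: "x = (s, v, t)" by (cases x)
    have "s = 0" "t = 0" "h v u = 0" for u
      using x[rule_format, of "(0, 0, 1)"] x[rule_format, of "(1, 0, 0)"]
        x[rule_format, of "(0, u, 0)"]
      by (auto simp: double_extension_metric_def h_simps)
    then show ?thesis
      using nondegenerate_h by (simp add: zero_prod_def)
  qed
  moreover have "double_extension_metric h (double_extension h D x y) z =
      - double_extension_metric h y (double_extension h D x z)" for x y z
  proof -
    obtain s v t s' v' t' s'' v'' t''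
      where [simp]: "x = (s, v, t)" "y = (s', v', t')" "z = (s'', v'', t'')"
      by (metis prod_cases3)
    show ?thesis
      by (simp add: double_extension_metric_def double_extension_def h_simps skew_D[of v' v'']
          sym_h[of v' "D v"] algebra_simps)
  qed
  moreover have "double_extension_metric h x y = double_extension_metric h y x" for x y
    by (cases x; cases y) (simp add: double_extension_metric_def sym_h algebra_simps)
  ultimately show ?thesis
    unfolding ad_invariant_metric_def by blast
qed

text \<open>Bracketing \<open>w + t z\<close>, \<open>w \<noteq> 0\<close>, with a suitable element of \<open>V\<close> gives a nonzero multiple of \<open>z\<close>, by
  nondegeneracy. An element with nonzero \<open>d\<close>-coefficient is first moved into \<open>V \<oplus> \<real>z\<close> by
  a bracket whose \<open>V\<close>-component is nonzero.\<close>

lemma center_in_ideal: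
  assumes surj: "surj D" and nontrivial: "u \<noteq> (0 :: 'v)"
    and I: "lie_ideal (double_extension h D) I" "I \<noteq> {0}"
  shows "(0, 0, 1) \<in> I"
proof -
  have sub: "subspace I" and ideal: "\<And>x y. y \<in> I \<Longrightarrow> double_extension h D x y \<in> I"
    using I(1) unfolding lie_ideal_def by auto
  have multiple: "(0, 0, 1) \<in> I" if "(0, 0, r) \<in> I" "r \<noteq> 0" for r
    using subspace_scale[OF sub that(1), of "1 / r"] that(2) by simp
  have V: "(0, 0, 1) \<in> I" if w: "(0, w, t) \<in> I" "w \<noteq> 0" for w t
  proof -
    obtain v where "h w (D v) \<noteq> 0"
      using nondegenerate_h[of w] w(2) surj by (metis surjD)
    moreover have "(0, 0, h (D v) w) \<in> I"
      using ideal[OF w(1), of "(0, v, 0)"] by (simp add: double_extension_def)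
    ultimately show ?thesis
      using multiple sym_h by metis
  qed
  obtain s w t where x: "(s, w, t) \<in> I" "(s, w, t) \<noteq> 0"
    using I(2) subspace_0[OF sub] by (metis prod_cases3 insertI1 singletonD subsetI subset_antisym)
  show ?thesis
  proof (cases "s = 0")
    case True
    with x V multiple show ?thesis by (cases "w = 0") (auto simp: zero_prod_def)
  next
    case False
    obtain v where v: "D v = u"
      using surj by (metis surjD)
    have "(0, - s *\<^sub>R u, h u w) \<in> I"
      using ideal[OF x(1), of "(0, v, 0)"] v by (simp add: double_extension_def)
    then show ?thesis
      using V nontrivial False by fastforce
  qed
qed

lemma irreducible_double_extension:
  assumes "surj D" "u \<noteq> (0 :: 'v)"
  shows "irreducible_lie (double_extension h D)"
proof -
  have "(0, 0, 1) \<noteq> (0 :: real \<times> 'v \<times> real)"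
    by (simp add: zero_prod_def)
  then show ?thesis
    unfolding irreducible_lie_def using center_in_ideal[OF assms] by blast
qed

text \<open>An eigenvector \<open>\<pi>\<close> of the transpose of \<open>D\<close> extends to one of the transpose of
  \<open>ad (s, w, r)\<close>: since \<open>[(s, w, r), d] = - D w\<close>, the value at \<open>d\<close> has to be \<open>- \<pi> w / s\<close>.\<close>

lemma double_extension_transpose_eigenvector:
  fixes \<pi> :: "'v \<Rightarrow> complex"
  assumes \<pi>: "linear \<pi>" "\<pi> u \<noteq> 0" "\<And>v. \<pi> (D v) = \<alpha> * \<pi> v"
    and b: "fst b \<noteq> 0"
  shows "\<exists>\<pi>'. linear \<pi>' \<and> (\<exists>v. \<pi>' v \<noteq> 0) \<and>
    (\<forall>x. \<pi>' (double_extension h D b x) = complex_of_real (fst b) * \<alpha> * \<pi>' x)"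
proof -
  obtain s w r where [simp]: "b = (s, w, r)" by (cases b)
  have [simp]: "s \<noteq> 0"
    using b by simp
  define \<pi>' where "\<pi>' = (\<lambda>x :: real \<times> 'v \<times> real. \<pi> (fst (snd x)) - (fst x / s) *\<^sub>R \<pi> w)"
  note \<pi>_simps = linear_add[OF \<pi>(1)] linear_diff[OF \<pi>(1)] linear_scale[OF \<pi>(1)]
  have "linear \<pi>'"
    by (rule linearI) (simp_all add: \<pi>'_def \<pi>_simps algebra_simps add_divide_distrib)
  moreover have "\<pi>' (0, u, 0) \<noteq> 0"
    using \<pi>(2) by (simp add: \<pi>'_def)
  moreover have "\<pi>' (double_extension h D b x) = complex_of_real (fst b) * \<alpha> * \<pi>' x" for x
    by (cases x)
      (simp add: \<pi>'_def double_extension_def \<pi>_simps \<pi>(3) scaleR_conv_of_real field_simps)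
  ultimately show ?thesis by blast
qed

end

section \<open>Transport along a linear isomorphism\<close>

text \<open>Dimension 12 is reached by a product type; the following transfers the structure to any
  other space of the same dimension.\<close>

locale bracket_transport =
  fixes T :: "'a::real_vector \<Rightarrow> 'b::real_vector" and S :: "'b \<Rightarrow> 'a" and br :: "'b \<Rightarrow> 'b \<Rightarrow> 'b"
  assumes linear_T: "linear T" and linear_S: "linear S"
    and ST [simp]: "S (T x) = x" and TS [simp]: "T (S y) = y"
begin

definition br' :: "'a \<Rightarrow> 'a \<Rightarrow> 'a" where
  "br' x y = S (br (T x) (T y))"

lemma lie_algebra_transport:
  assumes "lie_algebra br"
  shows "lie_algebra br'"
proof -
  have bil: "bilinear br" and alt: "\<And>x. br x x = 0"
    and jacobi: "\<And>x y z. br x (br y z) + br y (br z x) + br z (br x y) = 0"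
    using assms by (auto simp: lie_algebra_def)
  have "bilinear br'"
    unfolding bilinear_def br'_def
    by (auto intro!: linearI simp: linear_add[OF linear_T] linear_add[OF linear_S]
        linear_scale[OF linear_T] linear_scale[OF linear_S] bilinear_ladd[OF bil]
        bilinear_radd[OF bil] bilinear_lmul[OF bil] bilinear_rmul[OF bil])
  then show ?thesis
    unfolding lie_algebra_def br'_def
    by (simp add: alt jacobi linear_0[OF linear_S] flip: linear_add[OF linear_S])
qed

lemma ad_invariant_metric_transport:
  assumes "ad_invariant_metric br g"
  shows "ad_invariant_metric br' (\<lambda>x y. g (T x) (T y))"
proof -
  have bil: "bilinear g" and sym: "\<And>x y. g x y = g y x"
    and nondeg: "\<And>x. (\<And>y. g x y = 0) \<Longrightarrow> x = 0"
    and inv: "\<And>x y z. g (br x y) z = - g y (br x z)"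
    using assms unfolding ad_invariant_metric_def by blast+
  have "bilinear (\<lambda>x y. g (T x) (T y))"
    unfolding bilinear_def
    by (auto intro!: linearI simp: linear_add[OF linear_T] linear_scale[OF linear_T]
        bilinear_ladd[OF bil] bilinear_radd[OF bil] bilinear_lmul[OF bil] bilinear_rmul[OF bil])
  moreover have "\<forall>x. (\<forall>y. g (T x) (T y) = 0) \<longrightarrow> x = 0"
    using nondeg by (metis TS ST linear_0[OF linear_S])
  moreover have "\<forall>x y. g (T x) (T y) = g (T y) (T x)"
    by (intro allI) (rule sym)
  moreover have "\<forall>x y z. g (T (br' x y)) (T z) = - g (T y) (T (br' x z))"
    unfolding br'_def TS by (intro allI) (rule inv)
  ultimately show ?thesis
    unfolding ad_invariant_metric_def by (intro conjI)
qed

lemma irreducible_transport: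
  assumes "irreducible_lie br"
  shows "irreducible_lie br'"
  unfolding irreducible_lie_def
proof clarify
  fix I J
  assume I: "lie_ideal br' I" "I \<noteq> {0}" and J: "lie_ideal br' J" "J \<noteq> {0}"
    and int: "I \<inter> J = {0}" and sum: "{x + y | x y. x \<in> I \<and> y \<in> J} = UNIV"
  have inj: "inj T"
    by (metis ST injI)
  have ideal: "lie_ideal br (T ` K)" "T ` K \<noteq> {0}" if K: "lie_ideal br' K" "K \<noteq> {0}" for K
  proof -
    have "br x (T y) \<in> T ` K" if "y \<in> K" for x y
      using K(1) that unfolding lie_ideal_def br'_def by (metis TS imageI)
    then show "lie_ideal br (T ` K)"
      using K(1) linear_subspace_image[OF linear_T] unfolding lie_ideal_def by blast
    show "T ` K \<noteq> {0}"
      using K(2) inj linear_0[OF linear_T] by (metis image_empty image_insert inj_image_eq_iff)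
  qed
  have "T ` I \<inter> T ` J = {0}"
    using int inj linear_0[OF linear_T] by (simp flip: image_Int)
  moreover have "{x + y | x y. x \<in> T ` I \<and> y \<in> T ` J} = UNIV"
  proof -
    have "\<exists>x y. z = x + y \<and> x \<in> T ` I \<and> y \<in> T ` J" for z
    proof -
      obtain x y where "S z = x + y" "x \<in> I" "y \<in> J"
        using sum by blast
      then show ?thesis
        by (metis TS imageI linear_add[OF linear_T])
    qed
    then show ?thesis by blast
  qed
  ultimately show False
    using assms ideal[OF I] ideal[OF J] unfolding irreducible_lie_def by blast
qed

end

section \<open>The example in dimension 12\<close>

text \<open>A complex eigenvalue \<open>\<alpha>\<close> of a skew map comes with \<open>- \<alpha>\<close>. The two copies of \<open>\<complex>\<close> are paired
  complex bilinearly, so that \<open>\<alpha>\<close> and \<open>- \<alpha>\<close> act by multiplication.\<close>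

type_synonym ten_space = "complex \<times> complex \<times> (real^3) \<times> (real^3)"

definition h10 :: "ten_space \<Rightarrow> ten_space \<Rightarrow> real" where
  "h10 = (\<lambda>(p, q, a, b) (p', q', a', b'). Re (p * q' + q * p') + (a \<bullet> b' + b \<bullet> a'))"

definition D10 :: "ten_space \<Rightarrow> ten_space" where
  "D10 = (\<lambda>(p, q, a, b). (Complex 2 1 * p, - Complex 2 1 * q, a, - b))"

lemma surj_D10: "surj D10"
proof (rule surjI)
  show "D10 ((\<lambda>(p, q, a, b). (p / Complex 2 1, - q / Complex 2 1, a, - b)) x) = x" for x
    by (cases x) (auto simp: D10_def complex_eq_iff)
qed

interpretation ten: skew_map h10 D10
proof (rule skew_map.intro)
  show "bilinear h10"
    unfolding bilinear_def
    by (auto intro!: linearI simp: h10_def inner_add_left inner_add_right algebra_simps)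
  show "h10 u v = h10 v u" for u v
    by (cases u; cases v) (simp add: h10_def inner_commute algebra_simps)
  show "u = 0" if u: "\<And>v. h10 u v = 0" for u
  proof -
    obtain p q a b where [simp]: "u = (p, q, a, b)" by (cases u)
    have "p = 0" "q = 0" "a = 0" "b = 0"
      using u[of "(0, cnj p, 0, 0)"] u[of "(cnj q, 0, 0, 0)"] u[of "(0, 0, 0, a)"]
        u[of "(0, 0, b, 0)"]
      by (auto simp: h10_def complex_eq_iff)
    then show ?thesis by (simp add: zero_prod_def)
  qed
  show "linear D10"
    by (rule linearI) (auto simp: D10_def algebra_simps)
  show "h10 (D10 u) v = - h10 u (D10 v)" for u v
    by (cases u; cases v) (simp add: h10_def D10_def algebra_simps)
qed

theorem proposition1p6:
  shows "\<exists>br :: real^12 \<Rightarrow> real^12 \<Rightarrow> real^12.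
           lie_algebra br \<and> irreducible_lie br \<and> (\<exists>g. ad_invariant_metric br g) \<and> \<not> nice_lie br"
proof -
  have "DIM(real^12) = DIM(real \<times> ten_space \<times> real)"
    by simp
  then obtain T :: "real^12 \<Rightarrow> real \<times> ten_space \<times> real" and S
    where TS: "linear T" "linear S" "\<And>x. S (T x) = x" "\<And>y. T (S y) = y"
    by (rule isomorphisms_UNIV_UNIV) blast
  interpret bracket_transport T S "double_extension h10 D10"
    by (rule bracket_transport.intro) (fact TS)+
  have nontrivial: "(1, 0, 0, 0) \<noteq> (0 :: ten_space)"
    by (simp add: zero_prod_def)
  have lie: "lie_algebra br'"
    by (rule lie_algebra_transport) (rule ten.lie_algebra_double_extension)
  have "\<not> nice_lie br'"
  proof (rule not_nice_if_eigenvalue_without_real_power)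
    show "bilinear br'"
      using lie by (simp add: lie_algebra_def)
    show "linear (\<lambda>x. fst (T x))"
      using linear_compose[OF linear_T linear_fst] by (simp add: o_def)
    show "fst (T (S (1, 0, 0))) \<noteq> 0"
      by simp
    show "Complex 2 1 ^ m \<notin> \<real>" if "m > 0" for m
      using that by (rule power_two_plus_i_not_real)
    fix b assume b: "fst (T b) \<noteq> 0"
    have "linear (fst :: ten_space \<Rightarrow> complex)" "fst (1, 0, 0, 0) \<noteq> (0 :: complex)"
      "\<And>v. fst (D10 v) = Complex 2 1 * fst v"
      by (auto simp: linear_fst D10_def)
    from ten.double_extension_transpose_eigenvector
      [where \<pi> = fst and u = "(1, 0, 0, 0)" and \<alpha> = "Complex 2 1" and b = "T b", OF this b]
    obtain \<pi> v where \<pi>: "linear \<pi>" "\<pi> v \<noteq> 0"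
      "\<And>x. \<pi> (double_extension h10 D10 (T b) x) =
        complex_of_real (fst (T b)) * Complex 2 1 * \<pi> x"
      by blast
    show "\<exists>\<pi>. linear \<pi> \<and> (\<exists>v. \<pi> v \<noteq> 0) \<and>
      (\<forall>x. \<pi> (br' b x) = complex_of_real (fst (T b)) * Complex 2 1 * \<pi> x)"
    proof (intro exI conjI allI)
      show "linear (\<lambda>x. \<pi> (T x))"
        using linear_compose[OF linear_T \<pi>(1)] by (simp add: o_def)
      show "\<pi> (T (S v)) \<noteq> 0"
        using \<pi>(2) by simp
      show "\<pi> (T (br' b x)) = complex_of_real (fst (T b)) * Complex 2 1 * \<pi> (T x)" for x
        using \<pi>(3) by (simp add: br'_def)
    qed
  qed
  then show ?thesis
    using lie irreducible_transport[OF ten.irreducible_double_extension[OF surj_D10 nontrivial]]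
      ad_invariant_metric_transport[OF ten.ad_invariant_double_extension_metric]
    by blast
qed

end
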